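(* Let $T$ be a triangle in $\mathbb{R}^2$ and $d\in\{1,3,5\}$. There exist constants $C_1(p,d),C_2(p,d)>0$ depending only on $d$ and $p$, and $C_3(d)>0$ depending only on $d$, such that for any polynomial $\chi\in\mathbb{P}_N$ with $N\leq d$, the quadrature rule with domain points $\xi_{ijk}$ and weights $w_{ijk}$ (defined in the context) satisfies the Marcinkiewicz--Zygmund inequalities $$C_1(p,d)\int_T|\chi(x,y)|^p\,dx\,dy\leq \sum_{i+j+k=d}w_{ijk}|\chi(\xi_{ijk})|^p\leq C_2(p,d)K_0^p\int_T|\chi(x,y)|^p\,dx\,dy$$ for $1\leq p < \infty$, and $$C_3(d)\max_{i+j+k=d}|\chi(\xi_{ijk})|\leq \|\chi\|_{\infty,T}\leq K_0\max_{i+j+k=d}|\chi(\xi_{ijk})|$$ for $p=\infty$, where $K_0>0$ is the norm-equivalence constant described in the context. All these constants are independent of $N$.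
   Context: $T$ is a nondegenerate triangle with vertices $(x_1,y_1),(x_2,y_2),(x_3,y_3)$ and area $A_T$. $\mathbb{P}_d$ is the space of bivariate real polynomials of total degree at most $d$. $\|\cdot\|_{p,T}$ is the $L^p(T)$ norm. Indices are triples of nonnegative integers. Barycentric coordinates $(b_1,b_2,b_3)$ of $(x,y)$ solve $x=\sum_i b_ix_i$, $y=\sum_i b_iy_i$, $1=\sum_i b_i$. The Bernstein--Bézier polynomials are $B^T_{ijk}(x,y)=\frac{d!}{i!\,j!\,k!}b_1^ib_2^jb_3^k$, $i+j+k=d$. The domain points are $\xi_{ijk}=\frac{i(x_1,y_1)+j(x_2,y_2)+k(x_3,y_3)}{d}$, $i+j+k=d$. $\mathbf{B}$ is the (invertible) square matrix of size $\binom{d+2}{2}$ with entries $B^T_{lmn}(\xi_{ijk})$ (row index $ijk$, column index $lmn$, lexicographical order), and the weights are $w_{ijk}=\frac{A_T}{\binom{d+2}{2}}\sigma_{ijk}(\mathbf{B}^{-1})$, where $\sigma_{ijk}(\mathbf{B}^{-1})$ is the $ijk$-th column sum of $\mathbf{B}^{-1}$. For $d=1,3,5$ these weights are positive. Norm-equivalence constant (known result): $K_0>0$ is a constant depending only on $d$ such that, for every polynomial $P=\sum_{i+j+k=d}c_{ijk}B^T_{ijk}$ with coefficient vector $\mathbf{c}$, one has $\frac{\|\mathbf{c}\|_\infty}{K_0}\le\|P\|_{\infty,T}\le\|\mathbf{c}\|_\infty$ and $\frac{A_T^{1/p}}{K_0}\|\mathbf{c}\|_p\le\|P\|_{p,T}\le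 A_T^{1/p}\|\mathbf{c}\|_p$ for $1\le p<\infty$; $K_0=1$ when $p=\infty$ and $d=1$. *)

theory Defs
  imports
    "HOL-Probability.Essential_Supremum"
    "Jordan_Normal_Form.Gauss_Jordan_Elimination"
begin

type_synonym pt = "real \<times> real"
type_synonym idx = "nat \<times> nat \<times> nat"

definition tri :: "pt \<Rightarrow> pt \<Rightarrow> pt \<Rightarrow> pt set" where
  "tri v1 v2 v3 = convex hull {v1, v2, v3}"

definition area :: "pt \<Rightarrow> pt \<Rightarrow> pt \<Rightarrow> real" where
  "area v1 v2 v3 = measure lborel (tri v1 v2 v3)"

(* Bivariate real polynomials of total degree at most n, as functions on the plane. *)
definition poly_space :: "nat \<Rightarrow> (pt \<Rightarrow> real) set" where
  "poly_space n = {f. \<exists>a :: nat \<Rightarrow> nat \<Rightarrow> real.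
     \<forall>x y. f (x, y) = (\<Sum>(i, j) \<in> {(i, j). i + j \<le> n}. a i j * x ^ i * y ^ j)}"

(* Meaningful for finite p only; p = infinity is Linf_norm. *)
definition Lp_norm :: "real \<Rightarrow> pt set \<Rightarrow> (pt \<Rightarrow> real) \<Rightarrow> real" where
  "Lp_norm p T f = (LINT z:T|lborel. \<bar>f z\<bar> powr p) powr (1 / p)"

definition Linf_norm :: "pt set \<Rightarrow> (pt \<Rightarrow> real) \<Rightarrow> real" where
  "Linf_norm T f = real_of_ereal (esssup (restrict_space lborel T) (\<lambda>z. ereal \<bar>f z\<bar>))"

definition indices :: "nat \<Rightarrow> idx set" where
  "indices d = {(i, j, k). i + j + k = d}"

(* Lexicographical order d00, (d-1)10, (d-1)01, (d-2)20, ..., 00d. *)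
definition index_list :: "nat \<Rightarrow> idx list" where
  "index_list d = [(i, j, d - i - j). i \<leftarrow> rev [0..<d + 1], j \<leftarrow> rev [0..<d - i + 1]]"

definition index_pos :: "nat \<Rightarrow> idx \<Rightarrow> nat" where
  "index_pos d a = (THE r. r < length (index_list d) \<and> index_list d ! r = a)"

definition barycentric :: "pt \<Rightarrow> pt \<Rightarrow> pt \<Rightarrow> pt \<Rightarrow> real \<times> real \<times> real" where
  "barycentric v1 v2 v3 z = (THE (b1, b2, b3).
     fst z = b1 * fst v1 + b2 * fst v2 + b3 * fst v3 \<and>
     snd z = b1 * snd v1 + b2 * snd v2 + b3 * snd v3 \<and>
     1 = b1 + b2 + b3)"

definition bernstein :: "nat \<Rightarrow> pt \<Rightarrow> pt \<Rightarrow> pt \<Rightarrow> idx \<Rightarrow> pt \<Rightarrow> real" where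
  "bernstein d v1 v2 v3 = (\<lambda>(i, j, k) z.
     case barycentric v1 v2 v3 z of (b1, b2, b3) \<Rightarrow>
       fact d / (fact i * fact j * fact k) * b1 ^ i * b2 ^ j * b3 ^ k)"

definition domain_point :: "nat \<Rightarrow> pt \<Rightarrow> pt \<Rightarrow> pt \<Rightarrow> idx \<Rightarrow> pt" where
  "domain_point d v1 v2 v3 = (\<lambda>(i, j, k).
     (real i *\<^sub>R v1 + real j *\<^sub>R v2 + real k *\<^sub>R v3) /\<^sub>R real d)"

definition bb_matrix :: "nat \<Rightarrow> pt \<Rightarrow> pt \<Rightarrow> pt \<Rightarrow> real mat" where
  "bb_matrix d v1 v2 v3 = mat ((d + 2) choose 2) ((d + 2) choose 2)
     (\<lambda>(r, c). bernstein d v1 v2 v3 (index_list d ! c) (domain_point d v1 v2 v3 (index_list d ! r)))"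

definition column_sum :: "real mat \<Rightarrow> nat \<Rightarrow> real" where
  "column_sum M c = (\<Sum>r < dim_row M. M $$ (r, c))"

definition weight :: "nat \<Rightarrow> pt \<Rightarrow> pt \<Rightarrow> pt \<Rightarrow> idx \<Rightarrow> real" where
  "weight d v1 v2 v3 a = area v1 v2 v3 / real ((d + 2) choose 2) *
     column_sum (the (mat_inverse (bb_matrix d v1 v2 v3))) (index_pos d a)"

definition bb_poly :: "nat \<Rightarrow> pt \<Rightarrow> pt \<Rightarrow> pt \<Rightarrow> (idx \<Rightarrow> real) \<Rightarrow> pt \<Rightarrow> real" where
  "bb_poly d v1 v2 v3 c z = (\<Sum>a \<in> indices d. c a * bernstein d v1 v2 v3 a z)"

definition coeff_norm :: "nat \<Rightarrow> real \<Rightarrow> (idx \<Rightarrow> real) \<Rightarrow> real" where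
  "coeff_norm d p c = (\<Sum>a \<in> indices d. \<bar>c a\<bar> powr p) powr (1 / p)"

definition coeff_norm_inf :: "nat \<Rightarrow> (idx \<Rightarrow> real) \<Rightarrow> real" where
  "coeff_norm_inf d c = Max ((\<lambda>a. \<bar>c a\<bar>) ` indices d)"

(* K is uniform in the triangle, the polynomial and the exponent, i.e. it depends on d only. *)
definition norm_equiv_const :: "nat \<Rightarrow> real \<Rightarrow> bool" where
  "norm_equiv_const d K \<longleftrightarrow> 0 < K \<and>
     (\<forall>v1 v2 v3 c. \<not> collinear {v1, v2, v3} \<longrightarrow>
        coeff_norm_inf d c / K \<le> Linf_norm (tri v1 v2 v3) (bb_poly d v1 v2 v3 c) \<and>
        Linf_norm (tri v1 v2 v3) (bb_poly d v1 v2 v3 c) \<le> coeff_norm_inf d c \<and>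
        (\<forall>p\<ge>1.
           area v1 v2 v3 powr (1 / p) / K * coeff_norm d p c
             \<le> Lp_norm p (tri v1 v2 v3) (bb_poly d v1 v2 v3 c) \<and>
           Lp_norm p (tri v1 v2 v3) (bb_poly d v1 v2 v3 c)
             \<le> area v1 v2 v3 powr (1 / p) * coeff_norm d p c))"

(* The factor used for p = infinity: there the value 1 is taken when d = 1. *)
definition K_inf :: "nat \<Rightarrow> real \<Rightarrow> real" where
  "K_inf d K = (if d = 1 then 1 else K)"

definition max_on_points :: "nat \<Rightarrow> pt \<Rightarrow> pt \<Rightarrow> pt \<Rightarrow> (pt \<Rightarrow> real) \<Rightarrow> real" where
  "max_on_points d v1 v2 v3 f = Max ((\<lambda>a. \<bar>f (domain_point d v1 v2 v3 a)\<bar>) ` indices d)"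

definition quad_rule :: "nat \<Rightarrow> pt \<Rightarrow> pt \<Rightarrow> pt \<Rightarrow> (pt \<Rightarrow> real) \<Rightarrow> real" where
  "quad_rule d v1 v2 v3 f =
     (\<Sum>a \<in> indices d. weight d v1 v2 v3 a * f (domain_point d v1 v2 v3 a))"

end

theory Submission
  imports Defs "Jordan_Normal_Form.Determinant"
begin

text \<open>
  A form of degree \<open>d\<close> in barycentric coordinates is interpolated at the domain points by the
  polynomials \<open>L_ijk = (d b1 gchoose i) (d b2 gchoose j) (d b3 gchoose k)\<close>. On the triangle each
  generalised binomial coefficient is at most the corresponding rising factorial over a factorial,
  so Vandermonde's identity bounds the Lebesgue constant by \<open>2 d - 1 choose d\<close>, that is, by
  1, 10 and 126 for \<open>d = 1, 3, 5\<close>. This gives the upper estimate for \<open>p = \<infinity>\<close>, because \<open>K0\<close>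
  is at least as large for \<open>d = 3, 5\<close>: applied with \<open>p = 1\<close> to a polynomial bounded by one on the
  triangle, the norm equivalence says that \<open>K0\<close> is at least the sum of its absolute Bernstein
  coefficients, which is 10 for the constant one and 217 for the Chebyshev polynomial of degree 5
  in \<open>b1\<close>. For finite \<open>p\<close>, the weights are the area times positive numbers depending only on
  \<open>d\<close>. The lower estimate again uses the Lebesgue constant, and the upper one compares the values
  at the domain points with the Bernstein coefficients.
\<close>

subsection \<open>Index triples\<close>

lemma set_index_list: "set (index_list d) = indices d"
proof -
  have "set (index_list d) = (\<Union>i\<in>{0..<d + 1}. (\<lambda>j. (i, j, d - i - j)) ` {0..<d - i + 1})"
    by (simp add: index_list_def del: upt_Suc)
  also have "\<dots> = indices d"
    by (fastforce simp: indices_def)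
  finally show ?thesis .
qed

lemma finite_indices [simp]: "finite (indices d)"
  by (simp flip: set_index_list)

lemma indices_Sigma:
  "indices d = (\<lambda>(i, j). (i, j, d - i - j)) ` (SIGMA i:{..d}. {..d - i})"
proof -
  have "(i, j, k) \<in> indices d \<longleftrightarrow> i \<le> d \<and> j \<le> d - i \<and> k = d - i - j" for i j k
    by (auto simp: indices_def)
  then show ?thesis by fastforce
qed

lemma sum_indices: "sum f (indices d) = (\<Sum>i\<le>d. \<Sum>j\<le>d - i. f (i, j, d - i - j))"
proof -
  have "inj_on (\<lambda>(i, j). (i, j, d - i - j)) (SIGMA i:{..d}. {..d - i})"
    by (auto simp: inj_on_def)
  then show ?thesis
    unfolding indices_Sigma by (subst sum.reindex) (simp_all add: sum.Sigma split_def)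
qed

lemma card_indices: "card (indices d) = (d + 2) choose 2"
proof -
  have "card (indices d) = (\<Sum>i\<le>d. Suc (d - i))"
    using sum_indices[of "\<lambda>_. 1 :: nat" d] by simp
  also have "\<dots> = (\<Sum>i\<le>d. Suc i)"
    by (rule sum.reindex_bij_witness[of _ "\<lambda>i. d - i" "\<lambda>i. d - i"]) auto
  also have "\<dots> = (d + 2) choose 2"
    by (induction d) (simp_all add: numeral_2_eq_2)
  finally show ?thesis .
qed

lemma length_index_list: "length (index_list d) = (d + 2) choose 2"
proof -
  have "length (index_list d) = (\<Sum>i\<leftarrow>rev [0..<Suc d]. Suc (d - i))"
    unfolding index_list_def length_concat map_map
    by (intro arg_cong[of _ _ sum_list] map_cong) (simp_all del: upt_Suc)
  also have "\<dots> = (\<Sum>i\<in>{0..<Suc d}. Suc (d - i))"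
    by (simp only: rev_map[symmetric] sum_list_rev interv_sum_list_conv_sum_set_nat set_upt)
  also have "\<dots> = card (indices d)"
    using sum_indices[of "\<lambda>_. 1 :: nat" d] by (simp add: atLeast0LessThan lessThan_Suc_atMost)
  finally show ?thesis by (simp add: card_indices)
qed

lemma distinct_index_list: "distinct (index_list d)"
  by (rule card_distinct) (simp add: set_index_list card_indices length_index_list)

lemma bij_index_list: "bij_betw ((!) (index_list d)) {..<(d + 2) choose 2} (indices d)"
  using bij_betw_nth[OF distinct_index_list, of "{..<(d + 2) choose 2}" d]
  by (simp add: length_index_list set_index_list)

lemma sum_index_list: "(\<Sum>r<(d + 2) choose 2. f (index_list d ! r)) = sum f (indices d)"
  by (rule sum.reindex_bij_betw[OF bij_index_list])

lemma index_list_in_indices: "r < (d + 2) choose 2 \<Longrightarrow> index_list d ! r \<in> indices d"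
  by (metis length_index_list nth_mem set_index_list)

lemma index_list_eq_iff:
  "r < (d + 2) choose 2 \<Longrightarrow> s < (d + 2) choose 2 \<Longrightarrow> index_list d ! r = index_list d ! s \<longleftrightarrow> r = s"
  by (simp add: distinct_index_list length_index_list nth_eq_iff_index_eq)

lemma index_pos:
  assumes "a \<in> indices d"
  shows "index_pos d a < (d + 2) choose 2" "index_list d ! index_pos d a = a"
proof -
  have "\<exists>!r. r < length (index_list d) \<and> index_list d ! r = a"
    using distinct_Ex1[OF distinct_index_list, of a d] assms by (simp add: set_index_list)
  from theI'[OF this] show "index_pos d a < (d + 2) choose 2" "index_list d ! index_pos d a = a"
    unfolding index_pos_def by (auto simp: length_index_list)
qed

subsection \<open>Forms in barycentric coordinates\<close>

definition bary_monom :: "idx \<Rightarrow> real \<times> real \<times> real \<Rightarrow> real" where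
  "bary_monom = (\<lambda>(i, j, k) (x, y, z). x ^ i * y ^ j * z ^ k)"

text \<open>Homogeneous polynomials in three free variables; the relation
  \<open>b1 + b2 + b3 = 1\<close> enters only when they are compared with functions on the
  plane.\<close>

definition forms :: "nat \<Rightarrow> (real \<times> real \<times> real \<Rightarrow> real) set" where
  "forms n = {f. \<exists>c. \<forall>b. f b = (\<Sum>a\<in>indices n. c a * bary_monom a b)}"

lemma forms_bary_monom: "a \<in> indices n \<Longrightarrow> bary_monom a \<in> forms n"
  unfolding forms_def
  by (auto intro!: exI[of _ "\<lambda>e. if e = a then 1 else 0"] simp: if_distrib[of "\<lambda>t. t * _"] cong: if_cong)

lemma forms_add: "f \<in> forms n \<Longrightarrow> g \<in> forms n \<Longrightarrow> (\<lambda>b. f b + g b) \<in> forms n"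
  unfolding forms_def
proof clarify
  fix c e assume "\<forall>b. f b = (\<Sum>a\<in>indices n. c a * bary_monom a b)" "\<forall>b. g b = (\<Sum>a\<in>indices n. e a * bary_monom a b)"
  then show "\<exists>c. \<forall>b. f b + g b = (\<Sum>a\<in>indices n. c a * bary_monom a b)"
    by (intro exI[of _ "\<lambda>a. c a + e a"]) (simp add: algebra_simps sum.distrib)
qed

lemma forms_scale: "f \<in> forms n \<Longrightarrow> (\<lambda>b. t * f b) \<in> forms n"
  unfolding forms_def
proof clarify
  fix c assume "\<forall>b. f b = (\<Sum>a\<in>indices n. c a * bary_monom a b)"
  then show "\<exists>c. \<forall>b. t * f b = (\<Sum>a\<in>indices n. c a * bary_monom a b)"
    by (intro exI[of _ "\<lambda>a. t * c a"]) (simp add: algebra_simps sum_distrib_left)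
qed

lemma forms_zero: "(\<lambda>b. 0) \<in> forms n"
  unfolding forms_def by (auto intro: exI[of _ "\<lambda>_. 0"])

lemma forms_sum: "(\<And>i. i \<in> I \<Longrightarrow> f i \<in> forms n) \<Longrightarrow> (\<lambda>b. \<Sum>i\<in>I. f i b) \<in> forms n"
  by (induction I rule: infinite_finite_induct) (auto intro: forms_zero forms_add)

lemma forms_one: "(\<lambda>b. 1) \<in> forms 0"
proof -
  have "bary_monom (0, 0, 0) = (\<lambda>b. 1)" by (auto simp: bary_monom_def fun_eq_iff)
  then show ?thesis using forms_bary_monom[of "(0, 0, 0)" 0] by (simp add: indices_def)
qed

definition linear_form :: "real \<Rightarrow> real \<Rightarrow> real \<Rightarrow> real \<times> real \<times> real \<Rightarrow> real" where
  "linear_form p q r = (\<lambda>(x, y, z). p * x + q * y + r * z)"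

text \<open>A linear form times a monomial is a combination of three monomials with one exponent
  raised. The products below are built this way from the constant one.\<close>

lemma forms_mult_linear:
  assumes "f \<in> forms n"
  shows "(\<lambda>b. linear_form p q r b * f b) \<in> forms (Suc n)"
proof -
  obtain c where c: "\<And>b. f b = (\<Sum>a\<in>indices n. c a * bary_monom a b)"
    using assms by (auto simp: forms_def)
  have eq: "linear_form p q r b * f b = (\<Sum>(i, j, k)\<in>indices n. c (i, j, k) *
      (p * bary_monom (Suc i, j, k) b + (q * bary_monom (i, Suc j, k) b + r * bary_monom (i, j, Suc k) b)))" for b
    by (cases b) (auto simp: c linear_form_def sum_distrib_left bary_monom_def algebra_simps intro!: sum.cong)
  have "(\<lambda>b. case a of (i, j, k) \<Rightarrow> c (i, j, k) *
      (p * bary_monom (Suc i, j, k) b + (q * bary_monom (i, Suc j, k) b + r * bary_monom (i, j, Suc k) b))) \<in> forms (Suc n)"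
    if "a \<in> indices n" for a
    using that by (cases a) (auto simp: indices_def intro!: forms_scale forms_add forms_bary_monom)
  from forms_sum[OF this] show ?thesis unfolding eq .
qed

lemma forms_mult_prod_linear:
  assumes "f \<in> forms n"
  shows "(\<lambda>b. (\<Prod>s<m. linear_form (p s) (q s) (r s) b) * f b) \<in> forms (m + n)"
proof (induction m)
  case (Suc m)
  from forms_mult_linear[OF Suc.IH, of "p m" "q m" "r m"] show ?case
    by (simp add: mult_ac)
qed (use assms in simp)

lemma forms_mult_power_linear:
  assumes "f \<in> forms n"
  shows "(\<lambda>b. linear_form p q r b ^ m * f b) \<in> forms (m + n)"
  using forms_mult_prod_linear[OF assms, where p = "\<lambda>_. p" and q = "\<lambda>_. q" and r = "\<lambda>_. r"] by simp

text \<open>Depends on the barycentric coordinates alone, so what is computed from it is the same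
  for every triangle.\<close>

definition bform :: "nat \<Rightarrow> idx \<Rightarrow> real \<times> real \<times> real \<Rightarrow> real" where
  "bform d = (\<lambda>(i, j, k) (b1, b2, b3).
     fact d / (fact i * fact j * fact k) * b1 ^ i * b2 ^ j * b3 ^ k)"

lemma bernstein_eq_bform: "bernstein d v1 v2 v3 a z = bform d a (barycentric v1 v2 v3 z)"
  by (simp add: bernstein_def bform_def split: prod.splits)

lemma forms_bform:
  assumes "f \<in> forms d"
  obtains c where "\<And>b. f b = (\<Sum>a\<in>indices d. c a * bform d a b)"
proof -
  obtain c where c: "\<And>b. f b = (\<Sum>a\<in>indices d. c a * bary_monom a b)"
    using assms by (auto simp: forms_def)
  have "f b = (\<Sum>a\<in>indices d. (case a of (i, j, k) \<Rightarrow> c a * (fact i * fact j * fact k) / fact d) * bform d a b)" for b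
    unfolding c by (intro sum.cong) (auto simp: bary_monom_def bform_def split: prod.splits)
  then show thesis by (rule that)
qed

subsection \<open>Lagrange interpolation at the domain points\<close>

definition node :: "nat \<Rightarrow> idx \<Rightarrow> real \<times> real \<times> real" where
  "node d = (\<lambda>(i, j, k). (real i / real d, real j / real d, real k / real d))"

text \<open>The Lagrange basis of the lattice of nodes: \<open>real d * b1 gchoose i\<close>
  vanishes at \<open>b1 = s / d\<close> for naturals \<open>s < i\<close> and is one for
  \<open>s = i\<close>.\<close>

definition lagrange :: "nat \<Rightarrow> idx \<Rightarrow> real \<times> real \<times> real \<Rightarrow> real" where
  "lagrange d = (\<lambda>(i, j, k) (b1, b2, b3).
     (real d * b1 gchoose i) * (real d * b2 gchoose j) * (real d * b3 gchoose k))"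

text \<open>At a node the factors are ordinary binomial coefficients. Two distinct triples with
  equal sum have a component where \<open>e\<close> is smaller than \<open>a\<close>, and that
  factor vanishes.\<close>

lemma lagrange_node:
  assumes "0 < d" "a \<in> indices d" "e \<in> indices d"
  shows "lagrange d a (node d e) = (if a = e then 1 else 0)"
proof -
  obtain i j k l m n where a: "a = (i, j, k)" and e: "e = (l, m, n)" by (cases a, cases e)
  have "lagrange d a (node d e) = real ((l choose i) * (m choose j) * (n choose k))"
    using assms(1) by (simp add: a e lagrange_def node_def binomial_gbinomial)
  also have "\<dots> = (if a = e then 1 else 0)"
  proof (cases "a = e")
    case False
    have "l < i \<or> m < j \<or> n < k" using assms False by (auto simp: a e indices_def)
    then show ?thesis using False by auto
  qed (simp add: a e)
  finally show ?thesis .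
qed

text \<open>On the plane \<open>b1 + b2 + b3 = 1\<close> each factor \<open>d * b1 - s\<close> is homogeneous of degree one,
  so a Lagrange polynomial is a form of degree \<open>d\<close>.\<close>
lemma lagrange_forms:
  assumes "a \<in> indices d"
  obtains f where "f \<in> forms d" "\<And>b1 b2 b3. b1 + b2 + b3 = 1 \<Longrightarrow> lagrange d a (b1, b2, b3) = f (b1, b2, b3)"
proof -
  obtain i j k where a: "a = (i, j, k)" and d: "i + (j + (k + 0)) = d"
    using assms by (auto simp: indices_def)
  let ?P = "\<lambda>b. \<Prod>s<i. linear_form (real d - real s) (- real s) (- real s) b"
  let ?Q = "\<lambda>b. \<Prod>s<j. linear_form (- real s) (real d - real s) (- real s) b"
  let ?R = "\<lambda>b. \<Prod>s<k. linear_form (- real s) (- real s) (real d - real s) b"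
  have forms: "(\<lambda>b. 1 / (fact i * fact j * fact k) * (?P b * (?Q b * (?R b * 1)))) \<in> forms d"
    unfolding d[symmetric]
    by (rule forms_scale, rule forms_mult_prod_linear, rule forms_mult_prod_linear,
        rule forms_mult_prod_linear, rule forms_one)
  have "real d * b1 - real s = linear_form (real d - real s) (- real s) (- real s) (b1, b2, b3)"
       "real d * b2 - real s = linear_form (- real s) (real d - real s) (- real s) (b1, b2, b3)"
       "real d * b3 - real s = linear_form (- real s) (- real s) (real d - real s) (b1, b2, b3)"
    if "b1 + b2 + b3 = 1" for s b1 b2 b3
  proof -
    have b1: "b1 = 1 - b2 - b3" using that by simp
    show "real d * b1 - real s = linear_form (real d - real s) (- real s) (- real s) (b1, b2, b3)"
       "real d * b2 - real s = linear_form (- real s) (real d - real s) (- real s) (b1, b2, b3)"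
       "real d * b3 - real s = linear_form (- real s) (- real s) (real d - real s) (b1, b2, b3)"
      by (simp_all add: linear_form_def b1 algebra_simps)
  qed
  then have "lagrange d a (b1, b2, b3) = 1 / (fact i * fact j * fact k) *
      (?P (b1, b2, b3) * (?Q (b1, b2, b3) * (?R (b1, b2, b3) * 1)))" if "b1 + b2 + b3 = 1" for b1 b2 b3
    using that by (simp add: a lagrange_def gbinomial_prod_rev atLeast0LessThan)
  with forms show thesis by (rule that)
qed

text \<open>\<open>X e a\<close> is the Bernstein coefficient at \<open>e\<close> of the Lagrange
  polynomial of \<open>a\<close>. Evaluation at the nodes says that \<open>B * X\<close> is the
  identity. As the matrices are square, so is \<open>X * B\<close>, which is the second claim and
  yields the inverse in the third.\<close>

lemma lagrange_bernstein_duality: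
  assumes "0 < d"
  obtains X where
    "\<And>a b1 b2 b3. a \<in> indices d \<Longrightarrow> b1 + b2 + b3 = 1 \<Longrightarrow>
       lagrange d a (b1, b2, b3) = (\<Sum>e\<in>indices d. X e a * bform d e (b1, b2, b3))"
    "\<And>e e'. e \<in> indices d \<Longrightarrow> e' \<in> indices d \<Longrightarrow>
       (\<Sum>a\<in>indices d. X e a * bform d e' (node d a)) = (if e = e' then 1 else 0)"
    "mat_inverse (mat ((d + 2) choose 2) ((d + 2) choose 2)
       (\<lambda>(r, c). bform d (index_list d ! c) (node d (index_list d ! r)))) =
     Some (mat ((d + 2) choose 2) ((d + 2) choose 2) (\<lambda>(r, c). X (index_list d ! r) (index_list d ! c)))"
proof -
  have "\<exists>c. \<forall>b1 b2 b3. b1 + b2 + b3 = 1 \<longrightarrow>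
      lagrange d a (b1, b2, b3) = (\<Sum>e\<in>indices d. c e * bform d e (b1, b2, b3))" if "a \<in> indices d" for a
    using lagrange_forms[OF that] forms_bform by metis
  then obtain Y where Y: "\<And>a b1 b2 b3. a \<in> indices d \<Longrightarrow> b1 + b2 + b3 = 1 \<Longrightarrow>
      lagrange d a (b1, b2, b3) = (\<Sum>e\<in>indices d. Y a e * bform d e (b1, b2, b3))"
    by metis
  define n where "n = (d + 2) choose 2"
  define B where "B = mat n n (\<lambda>(r, c). bform d (index_list d ! c) (node d (index_list d ! r)))"
  define X where "X = mat n n (\<lambda>(r, c). Y (index_list d ! c) (index_list d ! r))"
  have carrier: "B \<in> carrier_mat n n" "X \<in> carrier_mat n n" by (auto simp: B_def X_def)
  have node_Y: "(\<Sum>e\<in>indices d. Y a e * bform d e (node d a')) = (if a = a' then 1 else 0)"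
    if "a \<in> indices d" "a' \<in> indices d" for a a'
  proof -
    obtain i j k where a': "a' = (i, j, k)" by (cases a')
    have "(real i + real j + real k) / real d = 1"
      using that(2) assms by (auto simp: a' indices_def)
    then have "lagrange d a (node d a') = (\<Sum>e\<in>indices d. Y a e * bform d e (node d a'))"
      unfolding a' node_def prod.case by (intro Y that(1)) (simp add: add_divide_distrib)
    then show ?thesis using lagrange_node[OF assms that] by simp
  qed
  have "B * X = 1\<^sub>m n"
  proof (rule eq_matI)
    fix r c assume "r < dim_row (1\<^sub>m n :: real mat)" "c < dim_col (1\<^sub>m n :: real mat)"
    then have rc: "r < n" "c < n" by auto
    then have "(B * X) $$ (r, c) =
        (\<Sum>s<n. Y (index_list d ! c) (index_list d ! s) * bform d (index_list d ! s) (node d (index_list d ! r)))"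
      by (simp add: B_def X_def scalar_prod_def atLeast0LessThan mult.commute)
    also have "\<dots> = (if c = r then 1 else 0)"
      unfolding n_def sum_index_list[of "\<lambda>e. Y (index_list d ! c) e * bform d e (node d (index_list d ! r))"]
      using rc by (subst node_Y) (auto simp: n_def index_list_in_indices index_list_eq_iff)
    finally show "(B * X) $$ (r, c) = 1\<^sub>m n $$ (r, c)" using rc by simp
  qed (auto simp: B_def X_def)
  from mat_mult_left_right_inverse[OF carrier this] have XB: "X * B = 1\<^sub>m n" .
  \<comment> \<open>\<open>None\<close> contradicts that \<open>B\<close> is a unit; a returned
    \<open>Z\<close> equals \<open>X\<close> since inverses are unique.\<close>
  have inv: "mat_inverse B = Some X"
  proof (cases "mat_inverse B")
    case None
    from mat_inverse(1)[OF carrier(1) None] XB \<open>B * X = 1\<^sub>m n\<close> carrier show ?thesis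
      by (auto simp: Units_def ring_mat_def)
  next
    case (Some Z)
    from mat_inverse(2)[OF carrier(1) Some] have Z: "B * Z = 1\<^sub>m n" "Z \<in> carrier_mat n n" by auto
    have "X = X * (B * Z)" using Z carrier by simp
    also have "\<dots> = (X * B) * Z" using Z carrier by (simp add: assoc_mult_mat)
    also have "\<dots> = Z" using XB Z by simp
    finally show ?thesis using Some by simp
  qed
  have dual: "(\<Sum>a\<in>indices d. Y a e * bform d e' (node d a)) = (if e = e' then 1 else 0)"
    if e: "e \<in> indices d" "e' \<in> indices d" for e e'
  proof -
    let ?r = "index_pos d e" and ?c = "index_pos d e'"
    have rc: "?r < n" "?c < n" and ee: "index_list d ! ?r = e" "index_list d ! ?c = e'"
      using e by (simp_all only: n_def index_pos)
    have "(\<Sum>a\<in>indices d. Y a e * bform d e' (node d a)) =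
        (\<Sum>s<n. Y (index_list d ! s) e * bform d e' (node d (index_list d ! s)))"
      unfolding n_def by (rule sum_index_list[of "\<lambda>a. Y a e * bform d e' (node d a)", symmetric])
    also have "\<dots> = (X * B) $$ (?r, ?c)"
      using rc by (simp add: B_def X_def scalar_prod_def atLeast0LessThan ee)
    also have "\<dots> = (if ?r = ?c then 1 else 0)"
      using XB rc by simp
    also have "\<dots> = (if e = e' then 1 else 0)"
      using ee by metis
    finally show ?thesis .
  qed
  show thesis
    by (rule that[of "\<lambda>e a. Y a e"]) (fact Y, fact dual, fact inv[unfolded B_def X_def n_def])
qed

subsection \<open>The Lebesgue constant\<close>

text \<open>A sum over triples is an iterated Cauchy product, so a two-term convolution identity can
  be applied twice.\<close>

lemma sum_simplex_convolution:
  "(\<Sum>(i, j, k)\<in>indices n. f i * g j * h k :: real) = (\<Sum>i\<le>n. f i * (\<Sum>j\<le>n - i. g j * h (n - i - j)))"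
  by (simp add: sum_indices sum_distrib_left mult.assoc)

text \<open>The trinomial theorem by two uses of the binomial theorem. For
  \<open>x + y + z = 1\<close> it is the partition of unity.\<close>

lemma bform_sum: "(\<Sum>a\<in>indices n. bform n a (x, y, z)) = (x + y + z) ^ n"
proof -
  have binom: "(\<Sum>k\<le>m. u ^ k / fact k * (v ^ (m - k) / fact (m - k))) = (u + v) ^ m / fact m" for u v :: real and m
    unfolding binomial_ring sum_divide_distrib by (intro sum.cong) (auto simp: binomial_fact)
  have "(\<Sum>a\<in>indices n. bform n a (x, y, z)) =
      fact n * (\<Sum>(i, j, k)\<in>indices n. x ^ i / fact i * (y ^ j / fact j) * (z ^ k / fact k))"
    unfolding sum_distrib_left by (intro sum.cong) (auto simp: bform_def)
  also have "\<dots> = (x + y + z) ^ n"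
    unfolding sum_simplex_convolution binom by (simp add: add.assoc)
  finally show ?thesis .
qed

lemma pochhammer_trinomial:
  fixes x y z :: real
  shows "(\<Sum>(i, j, k)\<in>indices n. pochhammer x i / fact i * (pochhammer y j / fact j) * (pochhammer z k / fact k)) =
    pochhammer (x + y + z) n / fact n"
proof -
  have binom: "(\<Sum>k\<le>m. pochhammer u k / fact k * (pochhammer v (m - k) / fact (m - k))) =
      pochhammer (u + v) m / fact m" for u v :: real and m
    unfolding pochhammer_binomial_sum sum_divide_distrib by (intro sum.cong) (auto simp: binomial_fact)
  show ?thesis unfolding sum_simplex_convolution binom by (simp add: add.assoc)
qed

text \<open>Factor by factor, \<open>\<bar>x - s\<bar> \<le> x + s\<close> for
  \<open>s \<ge> 0\<close>.\<close>

lemma abs_gbinomial_le: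
  fixes x :: real
  assumes "0 \<le> x"
  shows "\<bar>x gchoose n\<bar> \<le> pochhammer x n / fact n"
proof -
  have "\<bar>\<Prod>i = 0..<n. x - real i\<bar> \<le> (\<Prod>i = 0..<n. x + real i)"
    unfolding abs_prod using assms by (intro prod_mono) auto
  then show ?thesis
    by (simp add: gbinomial_prod_rev pochhammer_prod divide_right_mono)
qed

text \<open>Rising factorials majorise the factors, and by Vandermonde's identity the resulting sum
  depends only on \<open>b1 + b2 + b3\<close>, hence not on the point.\<close>

lemma lebesgue_function_le:
  assumes "0 < d" "0 \<le> b1" "0 \<le> b2" "0 \<le> b3" "b1 + b2 + b3 = 1"
  shows "(\<Sum>a\<in>indices d. \<bar>lagrange d a (b1, b2, b3)\<bar>) \<le> real (2 * d - 1 choose d)"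
proof -
  have "(\<Sum>a\<in>indices d. \<bar>lagrange d a (b1, b2, b3)\<bar>) \<le>
      (\<Sum>(i, j, k)\<in>indices d. pochhammer (real d * b1) i / fact i *
        (pochhammer (real d * b2) j / fact j) * (pochhammer (real d * b3) k / fact k))"
  proof (rule sum_mono, clarify)
    fix i j k
    show "\<bar>lagrange d (i, j, k) (b1, b2, b3)\<bar> \<le> pochhammer (real d * b1) i / fact i *
        (pochhammer (real d * b2) j / fact j) * (pochhammer (real d * b3) k / fact k)"
      unfolding lagrange_def prod.case abs_mult using assms
      by (intro mult_mono abs_gbinomial_le mult_nonneg_nonneg abs_ge_zero
            order_trans[OF abs_ge_zero abs_gbinomial_le]) simp_all
  qed
  also have "\<dots> = pochhammer (real d * (b1 + b2 + b3)) d / fact d"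
    unfolding pochhammer_trinomial by (simp add: distrib_left)
  \<comment> \<open>\<open>pochhammer d d\<close> is the product of the numbers from
    \<open>d\<close> to \<open>2 * d - 1\<close>.\<close>
  also have "\<dots> = (real (2 * d - 1) gchoose d)"
    using assms by (simp add: gbinomial_pochhammer' of_nat_diff)
  finally show ?thesis by (simp add: binomial_gbinomial)
qed

subsection \<open>Barycentric coordinates\<close>

text \<open>The expression is twice the signed area. If it vanished, the second point would lie on
  the line through the other two, with the parameter \<open>u\<close> read off a coordinate in which
  these differ.\<close>

lemma not_collinear_det:
  assumes "\<not> collinear {(x1, y1), (x2, y2), (x3, y3) :: real \<times> real}"
  shows "(x2 - x1) * (y3 - y1) - (x3 - x1) * (y2 - y1) \<noteq> 0"
proof
  assume D: "(x2 - x1) * (y3 - y1) - (x3 - x1) * (y2 - y1) = 0"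
  have "(x1, y1) \<noteq> (x3, y3)" using assms by (auto simp: collinear_3_expand)
  then consider "x1 \<noteq> x3" | "y1 \<noteq> y3" by auto
  then have "\<exists>u. x2 = u * x1 + (1 - u) * x3 \<and> y2 = u * y1 + (1 - u) * y3"
  proof cases
    case 1
    define u where "u = (x2 - x3) / (x1 - x3)"
    have u: "u * (x1 - x3) = x2 - x3" using 1 by (simp add: u_def)
    have "(y2 - (u * y1 + (1 - u) * y3)) * (x1 - x3) = (y2 - y3) * (x1 - x3) - u * (x1 - x3) * (y1 - y3)"
      by (simp add: algebra_simps)
    also have "\<dots> = 0" unfolding u using D by (simp add: algebra_simps)
    finally have "y2 = u * y1 + (1 - u) * y3" using 1 by simp
    moreover have "x2 = u * x1 + (1 - u) * x3" using u by (simp add: algebra_simps)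
    ultimately show ?thesis by blast
  next
    case 2
    define u where "u = (y2 - y3) / (y1 - y3)"
    have u: "u * (y1 - y3) = y2 - y3" using 2 by (simp add: u_def)
    have "(x2 - (u * x1 + (1 - u) * x3)) * (y1 - y3) = (x2 - x3) * (y1 - y3) - u * (y1 - y3) * (x1 - x3)"
      by (simp add: algebra_simps)
    also have "\<dots> = 0" unfolding u using D by (simp add: algebra_simps)
    finally have "x2 = u * x1 + (1 - u) * x3" using 2 by simp
    moreover have "y2 = u * y1 + (1 - u) * y3" using u by (simp add: algebra_simps)
    ultimately show ?thesis by blast
  qed
  then show False using assms by (auto simp: collinear_3_expand)
qed

text \<open>Two representations of a point differ by a solution of a homogeneous system with nonzero
  determinant, so the definite description is well defined.\<close>

lemma barycentric_eq:
  fixes v1 v2 v3 :: pt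
  assumes "\<not> collinear {v1, v2, v3}" "b1 + b2 + b3 = 1"
  shows "barycentric v1 v2 v3 (b1 *\<^sub>R v1 + b2 *\<^sub>R v2 + b3 *\<^sub>R v3) = (b1, b2, b3)"
proof -
  obtain x1 y1 x2 y2 x3 y3 where v: "v1 = (x1, y1)" "v2 = (x2, y2)" "v3 = (x3, y3)"
    by (cases v1, cases v2, cases v3)
  have D: "(x2 - x1) * (y3 - y1) - (x3 - x1) * (y2 - y1) \<noteq> 0"
    using not_collinear_det assms(1) unfolding v .
  have b1: "b1 = 1 - b2 - b3" using assms(2) by simp
  have "(c1, c2, c3) = (b1, b2, b3)"
    if "b1 * x1 + b2 * x2 + b3 * x3 = c1 * x1 + c2 * x2 + c3 * x3"
       "b1 * y1 + b2 * y2 + b3 * y3 = c1 * y1 + c2 * y2 + c3 * y3" "1 = c1 + c2 + c3" for c1 c2 c3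
  proof -
    have c1: "c1 = 1 - c2 - c3" using that(3) by simp
    have x: "(b2 - c2) * (x2 - x1) + (b3 - c3) * (x3 - x1) = 0"
      and y: "(b2 - c2) * (y2 - y1) + (b3 - c3) * (y3 - y1) = 0"
      using that(1,2) unfolding b1 c1 by (simp_all add: algebra_simps)
    have "(b2 - c2) * ((x2 - x1) * (y3 - y1) - (x3 - x1) * (y2 - y1)) =
        (y3 - y1) * ((b2 - c2) * (x2 - x1) + (b3 - c3) * (x3 - x1)) -
        (x3 - x1) * ((b2 - c2) * (y2 - y1) + (b3 - c3) * (y3 - y1))"
      "(b3 - c3) * ((x2 - x1) * (y3 - y1) - (x3 - x1) * (y2 - y1)) =
        (x2 - x1) * ((b2 - c2) * (y2 - y1) + (b3 - c3) * (y3 - y1)) -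
        (y2 - y1) * ((b2 - c2) * (x2 - x1) + (b3 - c3) * (x3 - x1))"
      by (simp_all add: algebra_simps)
    then have "b2 = c2" "b3 = c3" unfolding x y using D by simp_all
    then show ?thesis using b1 c1 by simp
  qed
  then show ?thesis
    unfolding barycentric_def v using assms(2)
    by (intro the_equality) auto
qed

lemma barycentric_exists:
  fixes v1 v2 v3 :: pt
  assumes "\<not> collinear {v1, v2, v3}"
  obtains b1 b2 b3 where "b1 + b2 + b3 = 1" "z = b1 *\<^sub>R v1 + b2 *\<^sub>R v2 + b3 *\<^sub>R v3"
proof -
  obtain x1 y1 x2 y2 x3 y3 x y where v: "v1 = (x1, y1)" "v2 = (x2, y2)" "v3 = (x3, y3)" "z = (x, y)"
    by (cases v1, cases v2, cases v3, cases z)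
  define D where "D = (x2 - x1) * (y3 - y1) - (x3 - x1) * (y2 - y1)"
  have "D \<noteq> 0"
    using not_collinear_det assms unfolding v D_def .
  \<comment> \<open>Cramer's rule for \<open>z - v1 = b2 (v2 - v1) + b3 (v3 - v1)\<close>.\<close>
  define b2 where "b2 = ((x - x1) * (y3 - y1) - (x3 - x1) * (y - y1)) / D"
  define b3 where "b3 = ((x2 - x1) * (y - y1) - (x - x1) * (y2 - y1)) / D"
  have b: "b2 * D = (x - x1) * (y3 - y1) - (x3 - x1) * (y - y1)"
       "b3 * D = (x2 - x1) * (y - y1) - (x - x1) * (y2 - y1)"
    using \<open>D \<noteq> 0\<close> by (simp_all add: b2_def b3_def)
  have D: "D * (x - ((1 - b2 - b3) * x1 + b2 * x2 + b3 * x3)) =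
      D * (x - x1) - (b2 * D) * (x2 - x1) - (b3 * D) * (x3 - x1)"
    "D * (y - ((1 - b2 - b3) * y1 + b2 * y2 + b3 * y3)) =
      D * (y - y1) - (b2 * D) * (y2 - y1) - (b3 * D) * (y3 - y1)"
    by (simp_all add: algebra_simps)
  have x: "D * (x - x1) - (b2 * D) * (x2 - x1) - (b3 * D) * (x3 - x1) = 0"
    unfolding b unfolding D_def by (simp add: algebra_simps)
  have y: "D * (y - y1) - (b2 * D) * (y2 - y1) - (b3 * D) * (y3 - y1) = 0"
    unfolding b unfolding D_def by (simp add: algebra_simps)
  have "x = (1 - b2 - b3) * x1 + b2 * x2 + b3 * x3" "y = (1 - b2 - b3) * y1 + b2 * y2 + b3 * y3"
    using D \<open>D \<noteq> 0\<close> unfolding x y by simp_all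
  then show thesis
    by (intro that[of "1 - b2 - b3" b2 b3]) (simp_all add: v)
qed

lemma tri_barycentric:
  assumes "z \<in> tri v1 v2 v3"
  obtains b1 b2 b3 where "0 \<le> b1" "0 \<le> b2" "0 \<le> b3" "b1 + b2 + b3 = 1"
    "z = b1 *\<^sub>R v1 + b2 *\<^sub>R v2 + b3 *\<^sub>R v3"
  using assms unfolding tri_def convex_hull_3 by auto

lemma domain_point_eq:
  "domain_point d v1 v2 v3 (i, j, k) =
     (real i / real d) *\<^sub>R v1 + (real j / real d) *\<^sub>R v2 + (real k / real d) *\<^sub>R v3"
  by (simp add: domain_point_def scaleR_add_right divide_inverse mult.commute)

lemma node_sum:
  assumes "0 < d" "(i, j, k) \<in> indices d"
  shows "real i / real d + real j / real d + real k / real d = 1"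
proof -
  have "real i + real j + real k = real d" using assms by (auto simp: indices_def)
  then show ?thesis using assms(1) by (simp flip: add_divide_distrib)
qed

lemma barycentric_domain_point:
  assumes "\<not> collinear {v1, v2, v3}" "0 < d" "a \<in> indices d"
  shows "barycentric v1 v2 v3 (domain_point d v1 v2 v3 a) = node d a"
proof -
  obtain i j k where a: "a = (i, j, k)" by (cases a)
  show ?thesis
    unfolding a domain_point_eq
    by (subst barycentric_eq[OF assms(1)]) (use node_sum assms a in \<open>auto simp: node_def\<close>)
qed

text \<open>Homogenisation: the coordinates become linear forms, and a monomial of degree
  \<open>i + j\<close> is multiplied by the power \<open>d - i - j\<close> of
  \<open>b1 + b2 + b3\<close>, which is one. From here on only \<open>c\<close> matters, so no
  constant depends on \<open>N\<close>.\<close>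

lemma poly_space_bb_poly:
  assumes "\<not> collinear {v1, v2, v3}" "N \<le> d" "q \<in> poly_space N"
  obtains c where "q = bb_poly d v1 v2 v3 c"
proof -
  obtain x1 y1 x2 y2 x3 y3 where v: "v1 = (x1, y1)" "v2 = (x2, y2)" "v3 = (x3, y3)"
    by (cases v1, cases v2, cases v3)
  obtain r where r: "\<And>x y. q (x, y) = (\<Sum>(i, j) \<in> {(i, j). i + j \<le> N}. r i j * x ^ i * y ^ j)"
    using assms(3) unfolding poly_space_def by auto
  define f where "f = (\<lambda>b. \<Sum>s\<in>{(i, j). i + j \<le> N}. case s of (i, j) \<Rightarrow> r i j *
    (linear_form x1 x2 x3 b ^ i * (linear_form y1 y2 y3 b ^ j * (linear_form 1 1 1 b ^ (d - i - j) * 1))))"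
  have "f \<in> forms d"
    unfolding f_def
  proof (rule forms_sum, clarify)
    fix i j assume "i + j \<le> N"
    then have d: "d = i + (j + ((d - i - j) + 0))" using assms(2) by simp
    show "(\<lambda>b. r i j * (linear_form x1 x2 x3 b ^ i * (linear_form y1 y2 y3 b ^ j *
        (linear_form 1 1 1 b ^ (d - i - j) * 1)))) \<in> forms d"
      by (rule ssubst[OF d, of "\<lambda>m. _ \<in> forms m"])
        (rule forms_scale, rule forms_mult_power_linear, rule forms_mult_power_linear,
         rule forms_mult_power_linear, rule forms_one)
  qed
  then obtain c where c: "\<And>b. f b = (\<Sum>a\<in>indices d. c a * bform d a b)"
    by (rule forms_bform) blast
  have "q z = bb_poly d v1 v2 v3 c z" for z
  proof -
    obtain b1 b2 b3 where b: "b1 + b2 + b3 = 1" "z = b1 *\<^sub>R v1 + b2 *\<^sub>R v2 + b3 *\<^sub>R v3"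
      using barycentric_exists[OF assms(1)] by blast
    have z: "z = (linear_form x1 x2 x3 (b1, b2, b3), linear_form y1 y2 y3 (b1, b2, b3))"
      by (simp add: b v linear_form_def mult.commute)
    have "linear_form 1 1 1 (b1, b2, b3) = 1" using b by (simp add: linear_form_def)
    then have "q z = f (b1, b2, b3)"
      unfolding z r f_def by (simp add: mult.assoc)
    also have "\<dots> = bb_poly d v1 v2 v3 c z"
      by (simp add: c bb_poly_def bernstein_eq_bform b(2) barycentric_eq[OF assms(1) b(1)])
    finally show ?thesis .
  qed
  then show thesis by (intro that[of c]) auto
qed

section \<open>Interpolation of Bernstein combinations\<close>

lemma bb_poly_domain_point:
  assumes "\<not> collinear {v1, v2, v3}" "0 < d" "a \<in> indices d"
  shows "bb_poly d v1 v2 v3 c (domain_point d v1 v2 v3 a) = (\<Sum>e\<in>indices d. c e * bform d e (node d a))"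
  by (simp add: bb_poly_def bernstein_eq_bform barycentric_domain_point[OF assms])

text \<open>Both factors are expanded in Bernstein polynomials; after exchanging sums, the sum over
  the nodes collapses by the duality for \<open>X\<close>.\<close>

lemma lagrange_interpolation:
  assumes "\<not> collinear {v1, v2, v3}" "0 < d" "b1 + b2 + b3 = 1"
  shows "bb_poly d v1 v2 v3 c (b1 *\<^sub>R v1 + b2 *\<^sub>R v2 + b3 *\<^sub>R v3) =
    (\<Sum>a\<in>indices d. bb_poly d v1 v2 v3 c (domain_point d v1 v2 v3 a) * lagrange d a (b1, b2, b3))"
proof -
  obtain X where X:
    "\<And>a b1 b2 b3. a \<in> indices d \<Longrightarrow> b1 + b2 + b3 = 1 \<Longrightarrow>
       lagrange d a (b1, b2, b3) = (\<Sum>e\<in>indices d. X e a * bform d e (b1, b2, b3))"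
    "\<And>e e'. e \<in> indices d \<Longrightarrow> e' \<in> indices d \<Longrightarrow>
       (\<Sum>a\<in>indices d. X e a * bform d e' (node d a)) = (if e = e' then 1 else 0)"
    by (rule lagrange_bernstein_duality[OF assms(2)]) (rule that)
  let ?B = "\<lambda>e. bform d e (b1, b2, b3)"
  have "(\<Sum>a\<in>indices d. bb_poly d v1 v2 v3 c (domain_point d v1 v2 v3 a) * lagrange d a (b1, b2, b3)) =
      (\<Sum>a\<in>indices d. (\<Sum>e'\<in>indices d. c e' * bform d e' (node d a)) * (\<Sum>e\<in>indices d. X e a * ?B e))"
    by (intro sum.cong refl) (simp add: bb_poly_domain_point[OF assms(1,2)] X(1)[OF _ assms(3)])
  also have "\<dots> = (\<Sum>a\<in>indices d. \<Sum>e\<in>indices d. \<Sum>e'\<in>indices d. c e' * ?B e * (X e a * bform d e' (node d a)))"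
    by (intro sum.cong refl) (subst sum_product, subst sum.swap, simp add: mult_ac)
  also have "\<dots> = (\<Sum>e\<in>indices d. \<Sum>a\<in>indices d. \<Sum>e'\<in>indices d. c e' * ?B e * (X e a * bform d e' (node d a)))"
    by (rule sum.swap)
  also have "\<dots> = (\<Sum>e\<in>indices d. \<Sum>e'\<in>indices d. \<Sum>a\<in>indices d. c e' * ?B e * (X e a * bform d e' (node d a)))"
    by (intro sum.cong refl sum.swap)
  also have "\<dots> = (\<Sum>e\<in>indices d. \<Sum>e'\<in>indices d. c e' * ?B e * (if e = e' then 1 else 0))"
    by (intro sum.cong refl) (simp add: X(2) flip: sum_distrib_left)
  also have "\<dots> = (\<Sum>e\<in>indices d. c e * ?B e)"
    by (intro sum.cong refl) (simp add: if_distrib[of "\<lambda>t. _ * t"] cong: if_cong)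
  also have "\<dots> = bb_poly d v1 v2 v3 c (b1 *\<^sub>R v1 + b2 *\<^sub>R v2 + b3 *\<^sub>R v3)"
    by (simp add: bb_poly_def bernstein_eq_bform barycentric_eq[OF assms(1,3)])
  finally show ?thesis by simp
qed

lemma abs_le_max_on_points:
  "a \<in> indices d \<Longrightarrow> \<bar>f (domain_point d v1 v2 v3 a)\<bar> \<le> max_on_points d v1 v2 v3 f"
  unfolding max_on_points_def by (rule Max_ge) auto

lemma indices_nonempty: "indices d \<noteq> {}"
proof -
  have "(d, 0, 0) \<in> indices d" by (simp add: indices_def)
  then show ?thesis by blast
qed

lemma max_on_points_attained:
  obtains a where "a \<in> indices d" "max_on_points d v1 v2 v3 f = \<bar>f (domain_point d v1 v2 v3 a)\<bar>"
proof -
  have "max_on_points d v1 v2 v3 f \<in> (\<lambda>a. \<bar>f (domain_point d v1 v2 v3 a)\<bar>) ` indices d"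
    unfolding max_on_points_def by (rule Max_in) (simp_all add: indices_nonempty)
  then show thesis using that by auto
qed

lemma abs_le_lebesgue_max_on_points:
  assumes "\<not> collinear {v1, v2, v3}" "0 < d" "z \<in> tri v1 v2 v3" "q = bb_poly d v1 v2 v3 c"
  shows "\<bar>q z\<bar> \<le> real (2 * d - 1 choose d) * max_on_points d v1 v2 v3 q"
proof -
  obtain b1 b2 b3 where b: "0 \<le> b1" "0 \<le> b2" "0 \<le> b3" "b1 + b2 + b3 = 1"
    "z = b1 *\<^sub>R v1 + b2 *\<^sub>R v2 + b3 *\<^sub>R v3"
    using assms(3) by (rule tri_barycentric)
  let ?M = "max_on_points d v1 v2 v3 q"
  have "0 \<le> ?M"
    using max_on_points_attained[of d v1 v2 v3 q] by (metis abs_ge_zero)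
  have "\<bar>q z\<bar> \<le> (\<Sum>a\<in>indices d. \<bar>q (domain_point d v1 v2 v3 a) * lagrange d a (b1, b2, b3)\<bar>)"
    unfolding assms(4) b(5) lagrange_interpolation[OF assms(1,2) b(4)] by (rule sum_abs)
  also have "\<dots> \<le> (\<Sum>a\<in>indices d. ?M * \<bar>lagrange d a (b1, b2, b3)\<bar>)"
    by (intro sum_mono) (simp add: abs_mult mult_right_mono abs_le_max_on_points)
  also have "\<dots> \<le> ?M * real (2 * d - 1 choose d)"
    unfolding sum_distrib_left[symmetric]
    by (intro mult_left_mono lebesgue_function_le assms b \<open>0 \<le> ?M\<close>)
  finally show ?thesis by (simp add: mult.commute)
qed

subsection \<open>Quadrature weights\<close>

text \<open>In matrix terms \<open>w\<close> solves \<open>w B = (1, ..., 1)\<close>. Multiplying by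
  the inverse shows that \<open>w\<close> is its vector of column sums, so a closed solution
  replaces the inversion.\<close>

lemma weight_eq:
  assumes "\<not> collinear {v1, v2, v3}" "0 < d" "a \<in> indices d"
    and w: "\<And>e. e \<in> indices d \<Longrightarrow> (\<Sum>a\<in>indices d. w a * bform d e (node d a)) = 1"
  shows "weight d v1 v2 v3 a = area v1 v2 v3 * (w a / real ((d + 2) choose 2))"
proof -
  let ?n = "(d + 2) choose 2"
  obtain X where X:
    "\<And>a b1 b2 b3. a \<in> indices d \<Longrightarrow> b1 + b2 + b3 = 1 \<Longrightarrow>
       lagrange d a (b1, b2, b3) = (\<Sum>e\<in>indices d. X e a * bform d e (b1, b2, b3))"
    "mat_inverse (mat ?n ?n (\<lambda>(r, c). bform d (index_list d ! c) (node d (index_list d ! r)))) =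
     Some (mat ?n ?n (\<lambda>(r, c). X (index_list d ! r) (index_list d ! c)))"
    by (rule lagrange_bernstein_duality[OF assms(2)]) (rule that)
  have dual: "(\<Sum>e\<in>indices d. X e a * bform d e (node d a')) = (if a = a' then 1 else 0)"
    if "a' \<in> indices d" for a'
  proof -
    obtain i j k where a': "a' = (i, j, k)" by (cases a')
    have "lagrange d a (node d a') = (\<Sum>e\<in>indices d. X e a * bform d e (node d a'))"
      using X(1)[OF assms(3) node_sum[OF assms(2)]] that unfolding a' node_def by simp
    then show ?thesis using lagrange_node[OF assms(2,3) that] by simp
  qed
  have "bb_matrix d v1 v2 v3 = mat ?n ?n (\<lambda>(r, c). bform d (index_list d ! c) (node d (index_list d ! r)))"
    unfolding bb_matrix_def
    by (intro cong_mat refl)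
      (simp only: prod.case bernstein_eq_bform barycentric_domain_point[OF assms(1,2) index_list_in_indices])
  then have "column_sum (the (mat_inverse (bb_matrix d v1 v2 v3))) (index_pos d a) =
      (\<Sum>r<?n. X (index_list d ! r) a)"
    using index_pos[OF assms(3)] by (simp add: X(2) column_sum_def del: add_2_eq_Suc')
  also have "\<dots> = (\<Sum>e\<in>indices d. X e a * 1)"
    by (simp add: sum_index_list[of "\<lambda>e. X e a"] del: add_2_eq_Suc')
  also have "\<dots> = (\<Sum>e\<in>indices d. X e a * (\<Sum>a'\<in>indices d. w a' * bform d e (node d a')))"
    by (intro sum.cong refl) (simp only: w)
  also have "\<dots> = (\<Sum>a'\<in>indices d. \<Sum>e\<in>indices d. w a' * (X e a * bform d e (node d a')))"
    by (subst sum.swap) (simp add: sum_distrib_left mult_ac)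
  also have "\<dots> = (\<Sum>a'\<in>indices d. w a' * (if a = a' then 1 else 0))"
    by (intro sum.cong refl) (simp add: dual flip: sum_distrib_left)
  also have "\<dots> = w a"
    using assms(3) by (simp add: if_distrib[of "\<lambda>t. _ * t"] cong: if_cong)
  finally show ?thesis by (simp add: weight_def)
qed

text \<open>The weights are invariant under permuting the vertices, and for \<open>d \<le> 5\<close> the sum of squares
  of an index triple identifies its orbit. They solve the linear system saying that the rule
  integrates every Bernstein polynomial exactly, normalised so that each of these integrals is one.\<close>
definition closed_weight :: "nat \<Rightarrow> idx \<Rightarrow> real" where
  "closed_weight d = (\<lambda>(i, j, k). let s = i * i + j * j + k * k in
     if d = 1 then 1
     else if d = 3 then (if s = 9 then 1 / 3 else if s = 5 then 3 / 4 else 9 / 2)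
     else (if s = 25 then 11 / 48 else if s = 11 then 25 / 6 else 25 / 48))"

lemma closed_weight_pos: "0 < closed_weight d a"
  by (cases a) (simp add: closed_weight_def Let_def)

lemma sum_indices_list: "sum f (indices d) = (\<Sum>a\<leftarrow>index_list d. f a)"
  by (simp add: sum.distinct_set_conv_list[OF distinct_index_list, unfolded set_index_list])

lemma index_list_1: "index_list 1 = [(1, 0, 0), (0, 1, 0), (0, 0, 1)]"
  by code_simp

lemma index_list_3: "index_list 3 =
  [(3, 0, 0), (2, 1, 0), (2, 0, 1), (1, 2, 0), (1, 1, 1), (1, 0, 2), (0, 3, 0), (0, 2, 1), (0, 1, 2), (0, 0, 3)]"
  by code_simp

lemma index_list_5: "index_list 5 =
  [(5, 0, 0), (4, 1, 0), (4, 0, 1), (3, 2, 0), (3, 1, 1), (3, 0, 2), (2, 3, 0), (2, 2, 1), (2, 1, 2), (2, 0, 3),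
   (1, 4, 0), (1, 3, 1), (1, 2, 2), (1, 1, 3), (1, 0, 4),
   (0, 5, 0), (0, 4, 1), (0, 3, 2), (0, 2, 3), (0, 1, 4), (0, 0, 5)]"
  by code_simp

text \<open>A finite check of 3, 10 or 21 rational equations. For \<open>d = 5\<close> the default
  value 25 / 48 is shared by the orbits of (4, 1, 0), (3, 2, 0) and (2, 2, 1).\<close>

lemma closed_weight_exact:
  assumes "d \<in> {1, 3, 5}" "e \<in> indices d"
  shows "(\<Sum>a\<in>indices d. closed_weight d a * bform d e (node d a)) = 1"
proof -
  consider "d = 1" | "d = 3" | "d = 5" using assms by auto
  then have "\<forall>e\<in>set (index_list d). (\<Sum>a\<leftarrow>index_list d. closed_weight d a * bform d e (node d a)) = 1"
  proof cases
    case 1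
    show ?thesis unfolding 1 index_list_1 by (simp add: closed_weight_def bform_def node_def)
  next
    case 2
    show ?thesis unfolding 2 index_list_3
      by (simp add: closed_weight_def bform_def node_def fact_numeral power_divide)
  next
    case 3
    show ?thesis unfolding 3 index_list_5
      by (simp add: closed_weight_def bform_def node_def fact_numeral power_divide)
  qed
  then show ?thesis using assms(2) by (simp only: sum_indices_list set_index_list)
qed

subsection \<open>Integrals and norms on a triangle\<close>

lemma compact_tri: "compact (tri v1 v2 v3)"
  unfolding tri_def by (intro finite_imp_compact_convex_hull) simp

lemma area_nonneg: "0 \<le> area v1 v2 v3"
  by (simp add: area_def)

text \<open>A function that is not integrable has integral zero by convention;
  \<open>0 \<le> C\<close> covers this case.\<close>

lemma set_integral_tri_le:
  fixes f :: "pt \<Rightarrow> real"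
  assumes "\<And>z. z \<in> tri v1 v2 v3 \<Longrightarrow> f z \<le> C" "0 \<le> C"
  shows "(LINT z:tri v1 v2 v3|lborel. f z) \<le> area v1 v2 v3 * C"
proof -
  have T: "tri v1 v2 v3 \<in> sets lborel" "emeasure lborel (tri v1 v2 v3) < \<infinity>"
    using borel_compact[OF compact_tri] emeasure_compact_finite[OF compact_tri] by simp_all
  have const: "(LINT z:tri v1 v2 v3|lborel. C) = area v1 v2 v3 * C"
    using T by (subst set_integral_const) (auto simp: area_def)
  show ?thesis
  proof (cases "set_integrable lborel (tri v1 v2 v3) f")
    case True
    moreover have "set_integrable lborel (tri v1 v2 v3) (\<lambda>_. C)"
      using T by (simp add: set_integrable_def)
    ultimately have "(LINT z:tri v1 v2 v3|lborel. f z) \<le> (LINT z:tri v1 v2 v3|lborel. C)"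
      by (rule set_integral_mono) (rule assms(1))
    then show ?thesis unfolding const .
  next
    case False
    then have "(LINT z:tri v1 v2 v3|lborel. f z) = 0"
      unfolding set_lebesgue_integral_def set_integrable_def by (rule not_integrable_integral_eq)
    then show ?thesis using assms(2) area_nonneg by simp
  qed
qed

text \<open>For a non-measurable function the essential supremum is infinite, and
  \<open>real_of_ereal\<close> sends infinite values to zero; \<open>0 \<le> C\<close> covers
  this.\<close>

lemma Linf_norm_le:
  assumes "\<And>z. z \<in> T \<Longrightarrow> \<bar>f z\<bar> \<le> C" "0 \<le> C"
  shows "Linf_norm T f \<le> C"
proof (cases "(\<lambda>z. ereal \<bar>f z\<bar>) \<in> borel_measurable (restrict_space lborel T)")
  case True
  then have "esssup (restrict_space lborel T) (\<lambda>z. ereal \<bar>f z\<bar>) \<le> ereal C"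
    using assms(1) by (intro esssup_I AE_I2) (auto simp: space_restrict_space)
  then show ?thesis
    unfolding Linf_norm_def using assms(2)
    by (cases "esssup (restrict_space lborel T) (\<lambda>z. ereal \<bar>f z\<bar>)") auto
next
  case False
  then show ?thesis
    unfolding Linf_norm_def using assms(2) by (simp add: esssup_non_measurable top_ereal_def)
qed

section \<open>Lower bounds for the norm-equivalence constant\<close>

lemma not_collinear_unit: "\<not> collinear {(0, 0), (1, 0), (0, 1) :: pt}"
  by (auto simp: collinear_3_expand)

text \<open>A square of side 1 / 2 fits into the triangle.\<close>

lemma area_unit_pos: "0 < area (0, 0) (1, 0) (0, 1)"
proof -
  have "cbox (0, 0) (1 / 2, 1 / 2) \<subseteq> tri (0, 0) (1, 0) (0, 1 :: real)"
  proof
    fix z :: pt assume "z \<in> cbox (0, 0) (1 / 2, 1 / 2)"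
    then have "0 \<le> fst z" "0 \<le> snd z" "fst z + snd z \<le> 1"
      by (auto simp: cbox_Pair_eq)
    moreover have "z = (0, 0) + fst z *\<^sub>R ((1, 0) - (0, 0)) + snd z *\<^sub>R ((0, 1) - (0, 0))"
      by (cases z) simp
    ultimately show "z \<in> tri (0, 0) (1, 0) (0, 1)"
      unfolding tri_def convex_hull_3_alt by blast
  qed
  then have "measure lborel (cbox (0, 0) (1 / 2, 1 / 2) :: pt set) \<le> area (0, 0) (1, 0) (0, 1)"
    unfolding area_def using compact_tri[of "(0, 0)" "(1, 0)" "(0, 1)"]
    by (intro measure_mono_fmeasurable) (auto intro: fmeasurable_compact)
  moreover have "0 < measure lborel (cbox (0, 0) (1 / 2, 1 / 2) :: pt set)"
    unfolding content_pos_lt_eq by (auto simp: Basis_prod_def)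
  ultimately show ?thesis by simp
qed

text \<open>The exponent \<open>p = 1\<close> in the norm equivalence: the coefficient norm is a sum, not a mean,
  which forces \<open>K\<close> to be large.\<close>
lemma norm_equiv_const_ge:
  assumes "norm_equiv_const d K"
    and "\<And>b1 b2 b3. 0 \<le> b1 \<Longrightarrow> 0 \<le> b2 \<Longrightarrow> 0 \<le> b3 \<Longrightarrow> b1 + b2 + b3 = 1 \<Longrightarrow>
      \<bar>\<Sum>a\<in>indices d. c a * bform d a (b1, b2, b3)\<bar> \<le> 1"
  shows "(\<Sum>a\<in>indices d. \<bar>c a\<bar>) \<le> K"
proof -
  \<comment> \<open>The constant is uniform in the triangle, so one triangle suffices; its positive
    area cancels.\<close>
  define u1 u2 u3 :: pt where u: "u1 = (0, 0)" "u2 = (1, 0)" "u3 = (0, 1)"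
  have nc: "\<not> collinear {u1, u2, u3}" unfolding u by (rule not_collinear_unit)
  have A: "0 < area u1 u2 u3" unfolding u by (rule area_unit_pos)
  have K: "0 < K" and "area u1 u2 u3 powr (1 / 1) / K * coeff_norm d 1 c
      \<le> Lp_norm 1 (tri u1 u2 u3) (bb_poly d u1 u2 u3 c)"
    using assms(1) nc unfolding norm_equiv_const_def by (blast, metis order_refl)
  then have "area u1 u2 u3 / K * (\<Sum>a\<in>indices d. \<bar>c a\<bar>) \<le> \<bar>LINT z:tri u1 u2 u3|lborel. \<bar>bb_poly d u1 u2 u3 c z\<bar>\<bar>"
    using A by (simp add: coeff_norm_def Lp_norm_def sum_nonneg)
  also have "\<dots> = (LINT z:tri u1 u2 u3|lborel. \<bar>bb_poly d u1 u2 u3 c z\<bar>)"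
    by (intro abs_of_nonneg) (simp add: set_lebesgue_integral_def)
  also have "\<dots> \<le> area u1 u2 u3 * 1"
  proof (rule set_integral_tri_le)
    fix z assume "z \<in> tri u1 u2 u3"
    then obtain b1 b2 b3 where b: "0 \<le> b1" "0 \<le> b2" "0 \<le> b3" "b1 + b2 + b3 = 1"
      "z = b1 *\<^sub>R u1 + b2 *\<^sub>R u2 + b3 *\<^sub>R u3"
      by (rule tri_barycentric)
    show "\<bar>bb_poly d u1 u2 u3 c z\<bar> \<le> 1"
      using assms(2)[OF b(1-4)]
      by (simp add: bb_poly_def bernstein_eq_bform b(5) barycentric_eq[OF nc b(4)])
  qed simp
  finally show ?thesis using A K by (simp add: field_simps)
qed

text \<open>By the partition of unity the constant one has ten Bernstein coefficients, all equal to
  one.\<close>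

lemma norm_equiv_const_ge_10:
  assumes "norm_equiv_const 3 K"
  shows "10 \<le> K"
proof -
  have "(\<Sum>a\<in>indices 3. \<bar>1 :: real\<bar>) \<le> K"
    by (rule norm_equiv_const_ge[OF assms]) (simp add: bform_sum)
  then show ?thesis using card_indices[of 3] by (simp add: choose_two)
qed

text \<open>The polynomial is the Chebyshev polynomial \<open>T_5\<close>, and the reason is Pell's
  equation \<open>T_5^2 + (1 - t^2) U_4^2 = 1\<close> with
  \<open>U_4 = 16 t^4 - 12 t^2 + 1\<close>.\<close>

lemma chebyshev_5_le_1:
  fixes t :: real
  assumes "\<bar>t\<bar> \<le> 1"
  shows "\<bar>16 * t ^ 5 - 20 * t ^ 3 + 5 * t\<bar> \<le> 1"
proof -
  have "(16 * t ^ 5 - 20 * t ^ 3 + 5 * t)\<^sup>2 = 1 - (1 - t\<^sup>2) * (16 * t ^ 4 - 12 * t\<^sup>2 + 1)\<^sup>2"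
    by (simp add: algebra_simps power2_eq_square eval_nat_numeral)
  moreover have "0 \<le> (1 - t\<^sup>2) * (16 * t ^ 4 - 12 * t\<^sup>2 + 1)\<^sup>2"
    using assms by (intro mult_nonneg_nonneg) (simp_all add: abs_square_le_1)
  ultimately show ?thesis by (simp flip: abs_square_le_1)
qed

text \<open>The list contains the Bernstein coefficients of the Chebyshev polynomial \<open>T_5 (2 x - 1)\<close>.\<close>
lemma norm_equiv_const_ge_217:
  assumes "norm_equiv_const 5 K"
  shows "217 \<le> K"
proof -
  let ?c = "\<lambda>a :: idx. [- 1, 9, - 21, 21, - 9, 1 :: real] ! fst a"
  have "(\<Sum>a\<in>indices 5. \<bar>?c a\<bar>) \<le> K"
  proof (rule norm_equiv_const_ge[OF assms])
    fix x y z :: real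
    assume b: "0 \<le> x" "0 \<le> y" "0 \<le> z" "x + y + z = 1"
    then have z: "z = 1 - x - y" by simp
    have "(\<Sum>a\<in>indices 5. ?c a * bform 5 a (x, y, z)) = 16 * (2 * x - 1) ^ 5 - 20 * (2 * x - 1) ^ 3 + 5 * (2 * x - 1)"
      unfolding sum_indices_list index_list_5 z
      by (simp add: bform_def fact_numeral algebra_simps eval_nat_numeral)
    then show "\<bar>\<Sum>a\<in>indices 5. ?c a * bform 5 a (x, y, z)\<bar> \<le> 1"
      using chebyshev_5_le_1[of "2 * x - 1"] b by simp
  qed
  \<comment> \<open>There are \<open>6 - i\<close> triples with first entry \<open>i\<close>, so the
    sum is 6 + 45 + 84 + 63 + 18 + 1 = 217.\<close>
  then show ?thesis by (simp add: sum_indices_list index_list_5)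
qed

text \<open>The bounds 1, 10 and 126 are compared with 1, 10 and 217. For \<open>d = 5\<close> the
  constant one would give only 21, hence the Chebyshev polynomial.\<close>

lemma lebesgue_bound_le_K_inf:
  assumes "d \<in> {1, 3, 5}" "norm_equiv_const d K"
  shows "real (2 * d - 1 choose d) \<le> K_inf d K"
proof -
  have "(5 choose 3) = (10 :: nat)" "(9 choose 5) = (126 :: nat)" by code_simp+
  then show ?thesis
    using assms norm_equiv_const_ge_10[of K] norm_equiv_const_ge_217[of K] by (auto simp: K_inf_def)
qed

text \<open>At a node the Bernstein polynomials are nonnegative with sum one, so the value is a
  convex combination of the coefficients.\<close>

lemma abs_bb_poly_domain_point_le:
  assumes "\<not> collinear {v1, v2, v3}" "0 < d" "a \<in> indices d"
    and "\<And>e. e \<in> indices d \<Longrightarrow> \<bar>c e\<bar> \<le> M"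
  shows "\<bar>bb_poly d v1 v2 v3 c (domain_point d v1 v2 v3 a)\<bar> \<le> M"
proof -
  obtain i j k where a: "a = (i, j, k)" by (cases a)
  have nonneg: "0 \<le> bform d e (node d a)" for e
    by (cases e) (simp add: a node_def bform_def)
  have "(\<Sum>e\<in>indices d. bform d e (node d a)) = 1"
    using node_sum[OF assms(2)] assms(3) by (simp add: a node_def bform_sum)
  then have M: "M = (\<Sum>e\<in>indices d. M * bform d e (node d a))"
    by (simp flip: sum_distrib_left)
  have "\<bar>bb_poly d v1 v2 v3 c (domain_point d v1 v2 v3 a)\<bar> \<le> (\<Sum>e\<in>indices d. \<bar>c e * bform d e (node d a)\<bar>)"
    unfolding bb_poly_domain_point[OF assms(1-3)] by (rule sum_abs)
  also have "\<dots> \<le> (\<Sum>e\<in>indices d. M * bform d e (node d a))"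
    using assms(4) by (intro sum_mono) (simp add: abs_mult nonneg mult_right_mono)
  finally show ?thesis using M by simp
qed

text \<open>The coefficients mediate between point values and an essential supremum: the largest one
  dominates the nodal values, and the norm equivalence bounds it.\<close>

lemma max_on_points_le_Linf_norm:
  assumes "norm_equiv_const d K" "\<not> collinear {v1, v2, v3}" "0 < d" "q = bb_poly d v1 v2 v3 c"
  shows "1 / K * max_on_points d v1 v2 v3 q \<le> Linf_norm (tri v1 v2 v3) q"
proof -
  have K: "0 < K" "coeff_norm_inf d c / K \<le> Linf_norm (tri v1 v2 v3) q"
    using assms unfolding norm_equiv_const_def by blast+
  obtain a where a: "a \<in> indices d" "max_on_points d v1 v2 v3 q = \<bar>q (domain_point d v1 v2 v3 a)\<bar>"
    by (rule max_on_points_attained)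
  have "max_on_points d v1 v2 v3 q \<le> coeff_norm_inf d c"
    unfolding a(2) coeff_norm_inf_def unfolding assms(4)
    by (intro abs_bb_poly_domain_point_le assms a Max_ge) auto
  then have "1 / K * max_on_points d v1 v2 v3 q \<le> coeff_norm_inf d c / K"
    using K(1) by (simp add: divide_right_mono)
  with K(2) show ?thesis by linarith
qed

section \<open>The two estimates for finite exponents\<close>

lemma quad_rule_eq:
  assumes "d \<in> {1, 3, 5}" "\<not> collinear {v1, v2, v3}"
  shows "quad_rule d v1 v2 v3 f = area v1 v2 v3 *
    (\<Sum>a\<in>indices d. closed_weight d a / real ((d + 2) choose 2) * f (domain_point d v1 v2 v3 a))"
  using assms
  by (auto simp: quad_rule_def sum_distrib_left mult.assoc weight_eq[where w = "closed_weight d"]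
      closed_weight_exact intro!: sum.cong)

text \<open>One node is enough: where the nodal maximum is attained, its value times the Lebesgue
  bound dominates \<open>q\<close> on the triangle. The other terms of the rule are nonnegative, as
  the weights are positive.\<close>

lemma integral_le_quad_rule:
  assumes d: "d \<in> {1, 3, 5}" and nc: "\<not> collinear {v1, v2, v3}" and q: "q = bb_poly d v1 v2 v3 c"
    and p: "1 \<le> p" and m: "0 < m" "\<And>a. a \<in> indices d \<Longrightarrow> m \<le> closed_weight d a / real ((d + 2) choose 2)"
  shows "m / real (2 * d - 1 choose d) powr p * (LINT z:tri v1 v2 v3|lborel. \<bar>q z\<bar> powr p)
    \<le> quad_rule d v1 v2 v3 (\<lambda>z. \<bar>q z\<bar> powr p)"
proof -
  let ?A = "area v1 v2 v3" and ?L = "real (2 * d - 1 choose d)" and ?\<xi> = "domain_point d v1 v2 v3"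
  have d0: "0 < d" using d by auto
  have L: "0 < ?L" using d0 by (simp add: zero_less_binomial)
  obtain a where a: "a \<in> indices d" "max_on_points d v1 v2 v3 q = \<bar>q (?\<xi> a)\<bar>"
    by (rule max_on_points_attained)
  have "(LINT z:tri v1 v2 v3|lborel. \<bar>q z\<bar> powr p) \<le> ?A * (?L * \<bar>q (?\<xi> a)\<bar>) powr p"
  proof (rule set_integral_tri_le)
    fix z assume "z \<in> tri v1 v2 v3"
    then have "\<bar>q z\<bar> \<le> ?L * \<bar>q (?\<xi> a)\<bar>"
      using abs_le_lebesgue_max_on_points[OF nc d0 _ q, of z] by (simp only: a(2))
    then show "\<bar>q z\<bar> powr p \<le> (?L * \<bar>q (?\<xi> a)\<bar>) powr p"
      using p by (intro powr_mono2) auto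
  qed simp
  then have "m / ?L powr p * (LINT z:tri v1 v2 v3|lborel. \<bar>q z\<bar> powr p) \<le>
      m / ?L powr p * (?A * (?L * \<bar>q (?\<xi> a)\<bar>) powr p)"
    using m(1) by (intro mult_left_mono) auto
  also have "\<dots> = ?A * (m * \<bar>q (?\<xi> a)\<bar> powr p)"
    using L by (simp add: powr_mult)
  also have "\<dots> \<le> ?A * (closed_weight d a / real ((d + 2) choose 2) * \<bar>q (?\<xi> a)\<bar> powr p)"
    using m(2)[OF a(1)] by (intro mult_left_mono mult_right_mono area_nonneg) auto
  also have "\<dots> \<le> ?A * (\<Sum>a\<in>indices d. closed_weight d a / real ((d + 2) choose 2) * \<bar>q (?\<xi> a)\<bar> powr p)"
    by (intro mult_left_mono area_nonneg member_le_sum a(1) finite_indices)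
      (simp add: less_imp_le[OF closed_weight_pos])
  finally show ?thesis unfolding quad_rule_eq[OF d nc] .
qed

text \<open>\<open>S\<close>, the \<open>p\<close>-th power of the coefficient norm, dominates
  \<open>\<bar>q z\<bar> powr p\<close> at every node, and the norm equivalence bounds area times
  \<open>S\<close> by \<open>K powr p\<close> times the integral.\<close>

lemma quad_rule_le_integral:
  assumes d: "d \<in> {1, 3, 5}" and nc: "\<not> collinear {v1, v2, v3}" and q: "q = bb_poly d v1 v2 v3 c"
    and p: "1 \<le> p" and K: "norm_equiv_const d K"
  shows "quad_rule d v1 v2 v3 (\<lambda>z. \<bar>q z\<bar> powr p) \<le>
    (\<Sum>a\<in>indices d. closed_weight d a / real ((d + 2) choose 2)) * K powr p *
      (LINT z:tri v1 v2 v3|lborel. \<bar>q z\<bar> powr p)"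
proof -
  let ?A = "area v1 v2 v3" and ?\<xi> = "domain_point d v1 v2 v3"
  let ?w = "\<lambda>a. closed_weight d a / real ((d + 2) choose 2)"
  define S where "S = (\<Sum>e\<in>indices d. \<bar>c e\<bar> powr p)"
  define I where "I = (LINT z:tri v1 v2 v3|lborel. \<bar>q z\<bar> powr p)"
  have d0: "0 < d" using d by auto
  have w: "0 \<le> ?w a" for a using closed_weight_pos[of d a] by simp
  have S: "0 \<le> S" unfolding S_def by (intro sum_nonneg) simp
  have I: "0 \<le> I" unfolding I_def set_lebesgue_integral_def by (intro Bochner_Integration.integral_nonneg) simp
  have "\<bar>q (?\<xi> a)\<bar> powr p \<le> S" if "a \<in> indices d" for a
  proof -
    have "\<bar>q (?\<xi> a)\<bar> \<le> S powr (1 / p)"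
      unfolding q
    proof (rule abs_bb_poly_domain_point_le[OF nc d0 that])
      fix e assume "e \<in> indices d"
      then have "\<bar>c e\<bar> powr p \<le> S"
        unfolding S_def by (intro member_le_sum) auto
      then have "(\<bar>c e\<bar> powr p) powr (1 / p) \<le> S powr (1 / p)"
        using p by (intro powr_mono2) auto
      then show "\<bar>c e\<bar> \<le> S powr (1 / p)" using p by (simp add: powr_powr)
    qed
    then have "\<bar>q (?\<xi> a)\<bar> powr p \<le> (S powr (1 / p)) powr p"
      using p by (intro powr_mono2) auto
    then show ?thesis using p S by (simp add: powr_powr)
  qed
  then have "(\<Sum>a\<in>indices d. ?w a * \<bar>q (?\<xi> a)\<bar> powr p) \<le> (\<Sum>a\<in>indices d. ?w a * S)"
    using w by (intro sum_mono mult_left_mono) auto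
  then have "quad_rule d v1 v2 v3 (\<lambda>z. \<bar>q z\<bar> powr p) \<le> ?A * (\<Sum>a\<in>indices d. ?w a * S)"
    unfolding quad_rule_eq[OF d nc] by (intro mult_left_mono area_nonneg)
  also have "\<dots> = (\<Sum>a\<in>indices d. ?w a) * (?A * S)"
    by (simp add: sum_distrib_left sum_distrib_right mult_ac)
  also have "\<dots> \<le> (\<Sum>a\<in>indices d. ?w a) * (K powr p * I)"
  proof (intro mult_left_mono sum_nonneg w)
    have K0: "0 < K" and *: "?A powr (1 / p) / K * coeff_norm d p c \<le> Lp_norm p (tri v1 v2 v3) q"
      using K nc p unfolding norm_equiv_const_def q by blast+
    have "?A powr (1 / p) * S powr (1 / p) \<le> K * I powr (1 / p)"
      using * K0 by (simp add: coeff_norm_def Lp_norm_def S_def I_def field_simps)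
    then have "(?A powr (1 / p) * S powr (1 / p)) powr p \<le> (K * I powr (1 / p)) powr p"
      using p by (intro powr_mono2) auto
    then show "?A * S \<le> K powr p * I"
      using p K0 S I area_nonneg[of v1 v2 v3] by (simp add: powr_mult powr_powr)
  qed
  finally show ?thesis by (simp add: I_def mult.assoc)
qed

theorem theorem3p3:
  fixes d :: nat
  assumes "d \<in> {1, 3, 5}"
  shows "\<exists>(C1 :: real \<Rightarrow> real) (C2 :: real \<Rightarrow> real) (C3 :: real).
    (\<forall>p\<ge>1. 0 < C1 p \<and> 0 < C2 p) \<and> 0 < C3 \<and>
    (\<forall>K0. norm_equiv_const d K0 \<longrightarrow>
      (\<forall>v1 v2 v3 N q. \<not> collinear {v1, v2, v3} \<longrightarrow> N \<le> d \<longrightarrow> q \<in> poly_space N \<longrightarrow>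
        (\<forall>p\<ge>1.
          C1 p * (LINT z:tri v1 v2 v3|lborel. \<bar>q z\<bar> powr p)
            \<le> quad_rule d v1 v2 v3 (\<lambda>z. \<bar>q z\<bar> powr p) \<and>
          quad_rule d v1 v2 v3 (\<lambda>z. \<bar>q z\<bar> powr p)
            \<le> C2 p * K0 powr p * (LINT z:tri v1 v2 v3|lborel. \<bar>q z\<bar> powr p)) \<and>
        C3 * max_on_points d v1 v2 v3 q \<le> Linf_norm (tri v1 v2 v3) q \<and>
        Linf_norm (tri v1 v2 v3) q \<le> K_inf d K0 * max_on_points d v1 v2 v3 q))"
proof (cases "\<exists>K. norm_equiv_const d K")
  \<comment> \<open>Without an admissible constant the claim about \<open>K0\<close> is vacuous, and
    any positive values do.\<close>
  case False
  then show ?thesis by (intro exI[of _ "\<lambda>_. 1"] exI[of _ 1]) simp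
next
  case True
  \<comment> \<open>Every admissible \<open>K\<close> yields an admissible \<open>C3 = 1 / K\<close>, so one of them can be fixed in advance.\<close>
  then obtain K where K: "norm_equiv_const d K" ..
  have d0: "0 < d" using assms by auto
  let ?w = "\<lambda>a. closed_weight d a / real ((d + 2) choose 2)"
  \<comment> \<open>The maximum may be attained at any node, so \<open>C1\<close> uses the smallest
    weight divided by the area.\<close>
  define m where "m = Min (?w ` indices d)"
  define C1 where "C1 = (\<lambda>p. m / real (2 * d - 1 choose d) powr p)"
  define C2 :: "real \<Rightarrow> real" where "C2 = (\<lambda>_. \<Sum>a\<in>indices d. ?w a)"
  have w: "0 < ?w a" for a
    using closed_weight_pos[of d a] by (simp add: zero_less_binomial)
  have m: "0 < m" "\<And>a. a \<in> indices d \<Longrightarrow> m \<le> ?w a"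
    unfolding m_def using w by (simp_all add: Min_gr_iff indices_nonempty)
  have C: "0 < C1 p" "0 < C2 p" for p
    using m(1) w d0 unfolding C1_def C2_def
    by (simp_all add: zero_less_binomial indices_nonempty sum_pos)
  have bounds: "(\<forall>p\<ge>1.
      C1 p * (LINT z:tri v1 v2 v3|lborel. \<bar>q z\<bar> powr p) \<le> quad_rule d v1 v2 v3 (\<lambda>z. \<bar>q z\<bar> powr p) \<and>
      quad_rule d v1 v2 v3 (\<lambda>z. \<bar>q z\<bar> powr p)
        \<le> C2 p * K0 powr p * (LINT z:tri v1 v2 v3|lborel. \<bar>q z\<bar> powr p)) \<and>
      1 / K * max_on_points d v1 v2 v3 q \<le> Linf_norm (tri v1 v2 v3) q \<and>
      Linf_norm (tri v1 v2 v3) q \<le> K_inf d K0 * max_on_points d v1 v2 v3 q"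
    if K0: "norm_equiv_const d K0" and nc: "\<not> collinear {v1, v2, v3}" and N: "N \<le> d" "q \<in> poly_space N"
    for K0 v1 v2 v3 N q
  proof -
    obtain c where q: "q = bb_poly d v1 v2 v3 c"
      using nc N by (rule poly_space_bb_poly)
    let ?M = "max_on_points d v1 v2 v3 q"
    have M: "0 \<le> ?M"
      using max_on_points_attained[of d v1 v2 v3 q] by (metis abs_ge_zero)
    have "Linf_norm (tri v1 v2 v3) q \<le> real (2 * d - 1 choose d) * ?M"
      using M abs_le_lebesgue_max_on_points[OF nc d0 _ q] by (intro Linf_norm_le) auto
    also have "\<dots> \<le> K_inf d K0 * ?M"
      using lebesgue_bound_le_K_inf[OF assms K0] M by (rule mult_right_mono)
    \<comment> \<open>\<open>K0\<close> enters the upper estimates only; the lower one for the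
      maximum uses the fixed \<open>K\<close>, so that \<open>C3\<close> is chosen before
      \<open>K0\<close>.\<close>
    finally show ?thesis
      unfolding C1_def C2_def
      using integral_le_quad_rule[OF assms nc q _ m] quad_rule_le_integral[OF assms nc q _ K0]
        max_on_points_le_Linf_norm[OF K nc d0 q] by blast
  qed
  show ?thesis
    by (rule exI[of _ C1], rule exI[of _ C2], rule exI[of _ "1 / K"])
      (use C bounds K in \<open>auto simp: norm_equiv_const_def simp del: One_nat_def\<close>)
qed

end
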